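(* Let $\sigma>0$, $A>0$, and let $f:\mathbb{R}\to\mathbb{R}$ be continuous, bandlimited to $\sigma$ rad/s, satisfy $|f(t)|\le A/(1+t^2)$ for all $t\in\mathbb{R}$, and not be identically zero. For $\alpha>A\sigma$ let $g_\alpha(t)=\alpha t+f(t)$ and $h_\alpha(u)=g_\alpha^{-1}(u)-u/\alpha$. Then, with the exception of at most one value of $\alpha\in(A\sigma,\infty)$, the function $h_\alpha$ is not bandlimited (i.e. there is no $\tau>0$ with $\hat h_\alpha(\xi)=0$ for all $|\xi|>\tau$).
   Context: Fourier transform convention: $\hat f(\xi)=\int_{\mathbb{R}}f(t)e^{-i2\pi\xi t}\,dt$. A function $f\in L^1(\mathbb{R})$ is bandlimited to $\sigma$ rad/s if $\hat f(\xi)=0$ for all $|\xi|>\sigma/(2\pi)$. For $\alpha>A\sigma$, $g_\alpha$ is a strictly increasing bijection of $\mathbb{R}$, so $g_\alpha^{-1}$ is defined on $\mathbb{R}$. *)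

theory Defs
  imports "HOL-Analysis.Analysis"
begin

definition fourier :: "(real \<Rightarrow> real) \<Rightarrow> real \<Rightarrow> complex" where
  "fourier f \<xi> = (LINT t|lborel. complex_of_real (f t) * exp (- (\<i> * complex_of_real (2 * pi * \<xi> * t))))"

text \<open>f in L^1(R) is bandlimited to sigma rad/s.\<close>
definition bandlimited :: "real \<Rightarrow> (real \<Rightarrow> real) \<Rightarrow> bool" where
  "bandlimited \<sigma> f \<longleftrightarrow> integrable lborel f \<and>
     (\<forall>\<xi>. \<bar>\<xi>\<bar> > \<sigma> / (2 * pi) \<longrightarrow> fourier f \<xi> = 0)"

definition bandlimited_hz :: "real \<Rightarrow> (real \<Rightarrow> real) \<Rightarrow> bool" where
  "bandlimited_hz \<tau> f \<longleftrightarrow> integrable lborel f \<and>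
     (\<forall>\<xi>. \<bar>\<xi>\<bar> > \<tau> \<longrightarrow> fourier f \<xi> = 0)"

definition g_fun :: "real \<Rightarrow> (real \<Rightarrow> real) \<Rightarrow> real \<Rightarrow> real" where
  "g_fun \<alpha> f t = \<alpha> * t + f t"

definition h_fun :: "real \<Rightarrow> (real \<Rightarrow> real) \<Rightarrow> real \<Rightarrow> real" where
  "h_fun \<alpha> f u = inv (g_fun \<alpha> f) u - u / \<alpha>"

end

theory Submission
  imports Defs "HOL-Probability.Probability" "HOL-Complex_Analysis.Complex_Analysis"
    "HOL-Real_Asymp.Real_Asymp"
begin

text \<open>By Fourier inversion, \<open>f\<close> and a bandlimited \<open>h\<^sub>\<alpha>\<close> agree almost everywhere on the reals with
  entire functions, so \<open>g\<^sub>\<alpha>\<close> and \<open>u \<mapsto> u / \<alpha> + h\<^sub>\<alpha> u\<close> extend to entire functions \<open>g\<close> and \<open>G\<close>.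
  Since \<open>g\<^sub>\<alpha>\<close> is surjective, \<open>inv g\<^sub>\<alpha>\<close> is a right inverse on the reals, and \<open>g \<circ> G = id\<close> on the whole
  plane by the identity theorem. Hence \<open>G\<close> tends to infinity at infinity and is a polynomial. As
  \<open>h\<^sub>\<alpha>\<close> is bounded on the reals, it is constant, and then so is \<open>f\<close>, which decays at infinity and
  therefore vanishes. So no exceptional value of \<open>\<alpha>\<close> occurs at all.

  Inversion is reduced to Levy's theorem for probability densities by writing an integrable
  function as a difference of two positive ones.\<close>

section \<open>Functions determined by their integrals over half-open intervals\<close>

text \<open>Half-open intervals form an intersection-stable generator of the Borel sets, so by
  Dynkin's argument the vanishing integrals spread to all Borel sets, which forces a null
  density.\<close>

lemma set_lebesgue_integral_Ioc_zero_imp_AE_zero: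
  fixes E :: "real \<Rightarrow> complex"
  assumes loc: "\<And>a b. set_integrable lborel {a<..b} E"
    and zero: "\<And>a b. a \<le> b \<Longrightarrow> (LINT x:{a<..b}|lborel. E x) = 0"
  shows "AE x in lborel. E x = 0"
proof -
  have Ioc: "(LINT x:{a<..b}|lborel. E x) = 0" for a b
    using zero[of a b] by (cases "a \<le> b") (auto simp: set_lebesgue_integral_def)
  \<comment> \<open>\<open>E\<close> is only locally integrable; the cut-off makes it integrable on
    the whole line, which the complement and union steps rely on.\<close>
  have "AE x in lborel. indicator {-real n<..real n} x *\<^sub>R E x = 0" for n :: nat
  proof (rule sigma_finite_measure.density_zero[OF lborel.sigma_finite_measure_axioms])
    let ?E = "\<lambda>x. indicator {-real n<..real n} x *\<^sub>R E x"
    show int: "integrable lborel ?E"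
      using loc by (simp add: set_integrable_def)
    have intA: "set_integrable lborel A ?E" if "A \<in> sets borel" for A
      unfolding set_integrable_def using integrable_mult_indicator[OF _ int, of A] that by simp
    have tot: "(LINT x|lborel. ?E x) = 0"
      using Ioc by (simp add: set_lebesgue_integral_def)
    have G: "sets borel = sigma_sets UNIV (range (\<lambda>(a, b). {a <.. b::real}))"
      by (subst borel_sigma_sets_Ioc) simp
    fix A :: "real set" assume "A \<in> sets lborel"
    then have A: "A \<in> sigma_sets UNIV (range (\<lambda>(a, b). {a <.. b::real}))"
      using G by simp
    have "Int_stable (range (\<lambda>(a, b). {a <.. b::real}))"
      and "range (\<lambda>(a, b). {a <.. b::real}) \<subseteq> Pow UNIV"
      by (auto simp: Int_stable_def)
    from this A show "set_lebesgue_integral lborel A ?E = 0"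
    proof (induction rule: sigma_sets_induct_disjoint)
      case (basic A)
      then obtain a b where A: "A = {a<..b}" by auto
      \<comment> \<open>Intersecting with the cut-off window gives another half-open interval,
        possibly empty.\<close>
      have "set_lebesgue_integral lborel A ?E =
          (LINT x:{max a (-real n)<..min b (real n)}|lborel. E x)"
        unfolding set_lebesgue_integral_def A
        by (intro Bochner_Integration.integral_cong) (auto split: split_indicator)
      then show ?case using Ioc by simp
    next
      case empty
      then show ?case by (simp add: set_lebesgue_integral_def)
    next
      case (compl A)
      then have A: "A \<in> sets borel" using G by simp
      have "set_lebesgue_integral lborel (UNIV - A) ?E =
          (LINT x|lborel. ?E x - indicator A x *\<^sub>R ?E x)"
        unfolding set_lebesgue_integral_def
        by (intro Bochner_Integration.integral_cong) (auto split: split_indicator)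
      also have "\<dots> = 0 - set_lebesgue_integral lborel A ?E"
        using int intA[OF A] tot
        by (subst Bochner_Integration.integral_diff)
           (auto simp: set_integrable_def set_lebesgue_integral_def)
      finally show ?case using compl by simp
    next
      case (union A)
      then have A: "\<And>i. A i \<in> sets borel" using G by auto
      have "(LINT x:(\<Union>i. A i)|lborel. ?E x) = (\<Sum>i. (LINT x:(A i)|lborel. ?E x))"
      proof (rule lebesgue_integral_countable_add)
        show "set_integrable lborel (\<Union>i. A i) ?E" using A by (intro intA) auto
      qed (use A union in \<open>auto simp: disjoint_family_on_def\<close>)
      then show ?case using union by simp
    qed
  qed
  then have "AE x in lborel. \<forall>n. indicator {-real n<..real n} x *\<^sub>R E x = 0"
    unfolding AE_all_countable by (rule allI)
  then show ?thesis
  proof eventually_elim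
    case (elim x)
    obtain n where "\<bar>x\<bar> < real n" using reals_Archimedean2 by blast
    then have "x \<in> {-real n<..real n}" by auto
    with elim[rule_format, of n] show ?case by simp
  qed
qed

section \<open>Levy inversion for integrable functions\<close>

lemma continuous_on_fourier_phase:
  fixes \<phi> :: "real \<Rightarrow> real"
  assumes "integrable lborel \<phi>"
  shows "continuous_on UNIV (\<lambda>t. CLINT x|lborel. complex_of_real (\<phi> x) * iexp (t * x))"
proof -
  have [measurable]: "\<phi> \<in> borel_measurable borel" using assms by auto
  have "isCont (\<lambda>t. CLINT x|lborel. complex_of_real (\<phi> x) * iexp (t * x)) t" for t
    unfolding continuous_at_sequentially comp_def
    using assms
    by (intro allI impI integral_dominated_convergence[where w="\<lambda>x. \<bar>\<phi> x\<bar>"])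
       (auto intro!: tendsto_intros simp: norm_mult)
  then show ?thesis by (simp add: continuous_at_imp_continuous_on)
qed

text \<open>The factor in Levy's inversion formula: for \<open>t \<noteq> 0\<close> it is the
  integral of \<open>exp (- \<i> t x)\<close> over \<open>{a..b}\<close>. Division by zero gives it
  the value 0 at \<open>t = 0\<close> instead of \<open>b - a\<close>, so it is not continuous there
  when \<open>a < b\<close>.\<close>

definition Levy_kernel :: "real \<Rightarrow> real \<Rightarrow> real \<Rightarrow> complex" where
  "Levy_kernel a b t = (iexp (-(t * a)) - iexp (-(t * b))) / (\<i> * t)"

lemma Levy_kernel_measurable [measurable]: "Levy_kernel a b \<in> borel_measurable borel"
  unfolding Levy_kernel_def by measurable

lemma norm_Levy_kernel_le:
  assumes "a \<le> b"
  shows "norm (Levy_kernel a b t) \<le> b - a"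
proof (cases "t = 0")
  case False
  then show ?thesis
    using Levy_Inversion_aux2[of "-b" "-a" t] assms by (simp add: Levy_kernel_def)
qed (use assms in \<open>simp add: Levy_kernel_def\<close>)

text \<open>Boundedness and measurability on a compact interval suffice, which avoids the jump of
  the kernel at 0.\<close>

lemma set_integrable_Levy_kernel:
  assumes "continuous_on UNIV \<psi>" "a \<le> b"
  shows "set_integrable lborel {c..d} (\<lambda>t. Levy_kernel a b t * \<psi> t)"
proof -
  have [measurable]: "\<psi> \<in> borel_measurable borel"
    using assms(1) by (rule borel_measurable_continuous_onI)
  have "bounded (\<psi> ` {c..d})"
    by (intro compact_imp_bounded compact_continuous_image) (auto intro: continuous_on_subset[OF assms(1)])
  then obtain B where B: "\<And>t. t \<in> {c..d} \<Longrightarrow> norm (\<psi> t) \<le> B"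
    unfolding bounded_iff by blast
  show ?thesis
    unfolding set_integrable_def
  proof (rule integrableI_bounded_set_indicator[where B = "(b - a) * B"])
    show "AE x in lborel. x \<in> {c..d} \<longrightarrow> norm (Levy_kernel a b x * \<psi> x) \<le> (b - a) * B"
      using B norm_Levy_kernel_le[OF assms(2)] assms(2)
      by (auto simp: norm_mult intro!: mult_mono)
  qed (auto simp: emeasure_lborel_Icc_eq)
qed

text \<open>The Fourier integral of \<open>p\<close> is the characteristic function of the measure
  with density \<open>p\<close>. Such a measure has no atoms, so Levy's theorem applies at all
  endpoints.\<close>

lemma Levy_inversion_density:
  fixes p :: "real \<Rightarrow> real"
  assumes p: "integrable lborel p" "\<And>x. 0 \<le> p x" "(LBINT x. p x) = 1" and "a \<le> b"
  shows "(\<lambda>n::nat. CLBINT t=-real n..real n. Levy_kernel a b t * (CLINT x|lborel. complex_of_real (p x) * iexp (t * x)))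
    \<longlonglongrightarrow> 2 * pi * (LBINT x:{a<..b}. p x)"
proof -
  have [measurable]: "p \<in> borel_measurable borel" using p by auto
  define M where "M = density lborel (\<lambda>x. ennreal (p x))"
  have "prob_space M"
    using p unfolding M_def
    by (intro prob_spaceI) (simp add: emeasure_density nn_integral_eq_integral)
  then interpret M: real_distribution M
    by (simp add: real_distribution_def real_distribution_axioms_def M_def)
  have meas: "measure M A = (LBINT x:A. p x)" if "A \<in> sets borel" for A
  proof -
    have "measure M A = (LINT x|M. indicator A x :: real)"
      using that by (simp add: M_def)
    also have "\<dots> = (LBINT x:A. p x)"
      unfolding M_def set_lebesgue_integral_def
      using that p by (subst integral_density) (auto simp: mult.commute)
    finally show ?thesis .
  qed
  have char: "char M t = (CLINT x|lborel. complex_of_real (p x) * iexp (t * x))" for t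
    unfolding M_def char_def using p by (subst integral_density) (auto simp: scaleR_conv_of_real)
  have null: "measure M {c} = 0" for c
    by (simp add: meas set_lebesgue_integral_def
        integral_eq_zero_AE AE_lborel_singleton[of c, THEN eventually_mono])
  have "(\<lambda>n::nat. 1 / (2 * pi) * (CLBINT t=-real n..real n. Levy_kernel a b t * char M t)) \<longlonglongrightarrow> measure M {a<..b}"
    using M.Levy_Inversion[OF \<open>a \<le> b\<close> null null]
    unfolding Levy_kernel_def of_int_minus of_int_of_nat_eq .
  from tendsto_mult_left[OF this, of "2 * pi"] show ?thesis
    by (simp add: char meas)
qed

text \<open>Both sides are linear in \<open>\<phi>\<close>, so it suffices to write
  \<open>\<phi>\<close> as a difference of two positive integrable functions and to normalise each
  to a probability density.\<close>

lemma Levy_inversion_integrable: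
  fixes \<phi> :: "real \<Rightarrow> real"
  assumes \<phi>: "integrable lborel \<phi>" and "a \<le> b"
  shows "(\<lambda>n::nat. CLBINT t=-real n..real n. Levy_kernel a b t * (CLINT x|lborel. complex_of_real (\<phi> x) * iexp (t * x)))
    \<longlonglongrightarrow> 2 * pi * (LBINT x:{a<..b}. \<phi> x)"
proof -
  \<comment> \<open>Added to the positive and the negative part of \<open>\<phi>\<close>, the
    Gaussian gives both of them nonzero mass to divide by, and it cancels in the difference.\<close>
  define w where "w = std_normal_density"
  have w: "integrable lborel w" "\<And>x. 0 < w x" "(LBINT x. w x) = 1"
    unfolding w_def by (auto simp: normal_density_pos)
  define L where "L p n = (CLBINT t=-real n..real n. Levy_kernel a b t * (CLINT x|lborel. complex_of_real (p x) * iexp (t * x)))"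
    for p :: "real \<Rightarrow> real" and n :: nat
  define \<psi> where "\<psi> p t = (CLINT x|lborel. complex_of_real (p x) * iexp (t * x))" for p :: "real \<Rightarrow> real" and t
  have pos: "L p \<longlonglongrightarrow> 2 * pi * (LBINT x:{a<..b}. p x)"
    if p: "integrable lborel p" "\<And>x. 0 < p x" for p
  proof -
    define c where "c = (LBINT x. p x)"
    have c: "c > 0"
    proof -
      have "c \<noteq> 0"
      proof
        assume "c = 0"
        then have "AE x in lborel. p x = 0"
          using p integral_nonneg_eq_0_iff_AE[of lborel p] by (auto simp: c_def less_imp_le)
        \<comment> \<open>The empty set is closed; were it of full measure, it would be the whole
          line.\<close>
        then have "AE x in lborel. (x::real) \<in> {}"
          by eventually_elim (metis p(2) less_irrefl)
        then show False
          using mem_closed_if_AE_lebesgue[of "{}" "0::real"] by (auto simp: AE_completion)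
      qed
      moreover have "c \<ge> 0" unfolding c_def using p(2) by (simp add: less_imp_le)
      ultimately show ?thesis by simp
    qed
    have "L (\<lambda>x. p x / c) \<longlonglongrightarrow> 2 * pi * (LBINT x:{a<..b}. p x / c)"
      unfolding L_def using p c \<open>a \<le> b\<close>
      by (intro Levy_inversion_density) (auto simp: c_def less_imp_le)
    moreover have "L (\<lambda>x. p x / c) = (\<lambda>n. L p n / c)"
      by (simp add: L_def fun_eq_iff del: of_real_mult)
    ultimately have "(\<lambda>n. L p n / c) \<longlonglongrightarrow> 2 * pi * (LBINT x:{a<..b}. p x) / c"
      by simp
    from tendsto_mult_right[OF this, of c] show ?thesis
      using c by simp
  qed
  have int: "interval_lebesgue_integrable lborel (ereal (-real n)) (ereal (real n)) (\<lambda>t. Levy_kernel a b t * \<psi> p t)"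
    if "integrable lborel p" for p n
    unfolding \<psi>_def
    using set_integrable_Levy_kernel[OF continuous_on_fourier_phase[OF that] \<open>a \<le> b\<close>, of "-real n" "real n"]
    by (simp add: interval_lebesgue_integrable_def set_integrable_subset[OF _ _ greaterThanLessThan_subseteq_atLeastAtMost_iff[THEN iffD2]])
  define p q where "p x = max 0 (\<phi> x) + w x" and "q x = max 0 (-\<phi> x) + w x" for x
  have [measurable]: "\<phi> \<in> borel_measurable borel" using \<phi> by auto
  have p: "integrable lborel p" "\<And>x. p x > 0" and q: "integrable lborel q" "\<And>x. q x > 0"
    using w \<phi> unfolding p_def q_def by (auto intro!: add_nonneg_pos)
  have eq: "\<phi> x = p x - q x" for x by (auto simp: p_def q_def max_def)
  have intc: "complex_integrable lborel (\<lambda>x. complex_of_real (r x) * iexp (t * x))" if "integrable lborel r" for r t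
  proof (rule Bochner_Integration.integrable_bound[OF that])
    have [measurable]: "r \<in> borel_measurable borel" using that by auto
    show "(\<lambda>x. complex_of_real (r x) * iexp (t * x)) \<in> borel_measurable lborel"
      by measurable
  qed (auto simp: norm_mult)
  have "\<psi> \<phi> t = \<psi> p t - \<psi> q t" for t
    unfolding \<psi>_def eq using intc[OF p(1)] intc[OF q(1)]
    by (simp add: left_diff_distrib del: of_real_mult)
  then have "L \<phi> n = L p n - L q n" for n
    using int[OF p(1)] int[OF q(1)]
    by (simp add: L_def right_diff_distrib flip: \<psi>_def del: of_real_mult)
  moreover have "(\<lambda>n. L p n - L q n) \<longlonglongrightarrow> 2 * pi * (LBINT x:{a<..b}. p x) - 2 * pi * (LBINT x:{a<..b}. q x)"
    unfolding of_real_diff by (intro tendsto_diff pos p q)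
  moreover have "(LBINT x:{a<..b}. \<phi> x) = (LBINT x:{a<..b}. p x) - (LBINT x:{a<..b}. q x)"
    unfolding eq using p q
    by (intro set_integral_diff) (auto simp: set_integrable_def intro!: integrable_mult_indicator simp del: real_scaleR_def)
  ultimately show ?thesis
    by (simp add: L_def right_diff_distrib)
qed

section \<open>Entire extension of bandlimited functions\<close>

lemma Levy_kernel_eq_integral:
  assumes "a \<le> b" "t \<noteq> 0"
  shows "Levy_kernel a b t = integral {a..b} (\<lambda>x. exp (- (\<i> * of_real t * of_real x)))"
proof -
  have "((\<lambda>x. exp (- (\<i> * of_real t * of_real x))) has_integral
     (- exp (- (\<i> * of_real t * of_real b)) / (\<i> * of_real t)) - (- exp (- (\<i> * of_real t * of_real a)) / (\<i> * of_real t))) {a..b}"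
  proof (rule fundamental_theorem_of_calculus[OF \<open>a \<le> b\<close>])
    fix x :: real
    have "((\<lambda>z. - exp (- (\<i> * of_real t * z)) / (\<i> * of_real t)) has_field_derivative exp (- (\<i> * of_real t * of_real x))) (at (of_real x))"
      using assms by (auto intro!: derivative_eq_intros)
    then show "((\<lambda>x. - exp (- (\<i> * of_real t * of_real x)) / (\<i> * of_real t)) has_vector_derivative exp (- (\<i> * of_real t * of_real x))) (at x within {a..b})"
      using has_vector_derivative_real_field[of _ _ x "{a..b}"] by blast
  qed
  then show ?thesis
    by (simp add: integral_unique Levy_kernel_def diff_divide_distrib mult.assoc)
qed

text \<open>Beyond the band the truncated integrals of Levy's formula stop changing, so the limit is
  an integral over a compact range. Writing the kernel as an integral over \<open>{a..b}\<close> and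
  exchanging the order produces the inverse Fourier integral \<open>F\<close>.\<close>

lemma bandlimited_integral_eq_entire:
  fixes \<phi> :: "real \<Rightarrow> real"
  assumes \<phi>: "integrable lborel \<phi>"
    and band: "\<And>t. \<bar>t\<bar> > \<tau> \<Longrightarrow> (CLINT x|lborel. complex_of_real (\<phi> x) * iexp (t * x)) = 0"
  obtains F where "F holomorphic_on UNIV"
    "\<And>a b. a \<le> b \<Longrightarrow> complex_of_real (LBINT x:{a<..b}. \<phi> x) = integral {a..b} (\<lambda>x. F (of_real x))"
proof -
  define \<psi> where "\<psi> t = (CLINT x|lborel. complex_of_real (\<phi> x) * iexp (t * x))" for t
  have cont: "continuous_on UNIV \<psi>"
    unfolding \<psi>_def[abs_def] by (rule continuous_on_fourier_phase[OF \<phi>])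
  have cont': "continuous_on S (\<lambda>x. \<psi> (g x))" if "continuous_on S g" for S and g :: "'z::topological_space \<Rightarrow> real"
    using continuous_on_compose2[OF cont that] by auto
  obtain N :: nat where N: "\<tau> < real N" using reals_Archimedean2 by blast
  \<comment> \<open>The inverse Fourier integral at a complex point; the compact range of
    \<open>t\<close> allows differentiation under the integral for every \<open>z\<close>.\<close>
  define F where "F z = 1 / (2 * pi) * integral (cbox (-real N) (real N)) (\<lambda>t. \<psi> t * exp (- (\<i> * of_real t * z)))" for z
  have hol: "F holomorphic_on UNIV"
    unfolding F_def[abs_def]
  proof (intro holomorphic_intros leibniz_rule_holomorphic)
    show "((\<lambda>z. \<psi> t * exp (- (\<i> * of_real t * z))) has_field_derivative
       \<psi> t * (- (\<i> * of_real t)) * exp (- (\<i> * of_real t * z))) (at z within UNIV)" for z t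
      by (auto intro!: derivative_eq_intros)
    show "(\<lambda>t. \<psi> t * exp (- (\<i> * of_real t * z))) integrable_on cbox (-real N) (real N)" for z
      by (intro integrable_continuous continuous_intros cont')
    show "continuous_on (UNIV \<times> cbox (-real N) (real N)) (\<lambda>(z, t). \<psi> t * (- (\<i> * of_real t)) * exp (- (\<i> * of_real t * z)))"
      unfolding case_prod_unfold by (intro continuous_intros cont')
  qed auto
  have "complex_of_real (LBINT x:{a<..b}. \<phi> x) = integral {a..b} (\<lambda>x. F (of_real x))"
    if ab: "a \<le> b" for a b
  proof -
  have si: "set_integrable lborel {c..d} (\<lambda>t. Levy_kernel a b t * \<psi> t)" for c d
    by (rule set_integrable_Levy_kernel[OF cont ab])
  have L: "(CLBINT t=-real n..real n. Levy_kernel a b t * \<psi> t) = (CLBINT t=-real N..real N. Levy_kernel a b t * \<psi> t)"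
    if "n \<ge> N" for n
  proof -
    have "(CLBINT t=-real n..real n. Levy_kernel a b t * \<psi> t) = (CLBINT t:{-real n..real n}. Levy_kernel a b t * \<psi> t)"
      by (rule interval_integral_Icc) simp
    also have "\<dots> = (CLBINT t:{-real N..real N}. Levy_kernel a b t * \<psi> t)"
      unfolding set_lebesgue_integral_def
    proof (intro Bochner_Integration.integral_cong refl)
      fix t :: real
      have "\<psi> t = 0" if "\<bar>t\<bar> > real N"
        using band[of t] that N by (simp add: \<psi>_def)
      then show "indicator {-real n..real n} t *\<^sub>R (Levy_kernel a b t * \<psi> t) = indicator {-real N..real N} t *\<^sub>R (Levy_kernel a b t * \<psi> t)"
        using \<open>n \<ge> N\<close> by (auto split: split_indicator)
    qed
    also have "\<dots> = (CLBINT t=-real N..real N. Levy_kernel a b t * \<psi> t)"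
      by (rule interval_integral_Icc[symmetric]) simp
    finally show ?thesis .
  qed
  have "(\<lambda>n. CLBINT t=-real n..real n. Levy_kernel a b t * \<psi> t) \<longlonglongrightarrow> (CLBINT t=-real N..real N. Levy_kernel a b t * \<psi> t)"
    by (rule tendsto_eventually, rule eventually_sequentiallyI[of N], rule L)
  then have "2 * pi * (LBINT x:{a<..b}. \<phi> x) = (CLBINT t=-real N..real N. Levy_kernel a b t * \<psi> t)"
    using Levy_inversion_integrable[OF \<phi> ab] LIMSEQ_unique unfolding \<psi>_def by blast
  also have "\<dots> = integral {-real N..real N} (\<lambda>t. Levy_kernel a b t * \<psi> t)"
    by (rule interval_integral_eq_integral) (auto intro: si)
  \<comment> \<open>The point \<open>t = 0\<close>, where the kernel has its default value, is
    negligible.\<close>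
  also have "\<dots> = integral {-real N..real N} (\<lambda>t. integral {a..b} (\<lambda>x. \<psi> t * exp (- (\<i> * of_real t * of_real x))))"
    by (rule integral_spike[of "{0}"]) (auto simp: Levy_kernel_eq_integral[OF ab] mult.commute)
  also have "\<dots> = integral {a..b} (\<lambda>x. integral {-real N..real N} (\<lambda>t. \<psi> t * exp (- (\<i> * of_real t * of_real x))))"
    using integral_swap_continuous[of "-real N" a "real N" b "\<lambda>t x. \<psi> t * exp (- (\<i> * of_real t * of_real x))"]
    by (simp add: case_prod_unfold cont' continuous_intros)
  also have "\<dots> = 2 * pi * integral {a..b} (\<lambda>x. F (of_real x))"
    unfolding F_def by (simp add: cbox_interval)
  finally show ?thesis
    by simp
  qed
  with hol show thesis using that by blast
qed

lemma bandlimited_AE_eq_entire: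
  fixes \<phi> :: "real \<Rightarrow> real"
  assumes "bandlimited_hz \<tau> \<phi>"
  obtains F where "F holomorphic_on UNIV" "AE x in lborel. complex_of_real (\<phi> x) = F (of_real x)"
proof -
  have \<phi>: "integrable lborel \<phi>" using assms by (simp add: bandlimited_hz_def)
  \<comment> \<open>The phase \<open>t * x\<close> corresponds to the frequency
    \<open>\<xi> = - t / (2 * pi)\<close>, with the sign reversed because \<open>fourier\<close> has
    a negative exponent.\<close>
  have "(CLINT x|lborel. complex_of_real (\<phi> x) * iexp (t * x)) = 0" if "\<bar>t\<bar> > 2 * pi * \<tau>" for t
  proof -
    have "\<bar>- t / (2 * pi)\<bar> > \<tau>" using that by (simp add: field_simps)
    then have "fourier \<phi> (- t / (2 * pi)) = 0"
      using assms unfolding bandlimited_hz_def by blast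
    then show ?thesis by (simp add: fourier_def)
  qed
  then obtain F where F: "F holomorphic_on UNIV"
    and eq: "\<And>a b. a \<le> b \<Longrightarrow> complex_of_real (LBINT x:{a<..b}. \<phi> x) = integral {a..b} (\<lambda>x. F (of_real x))"
    using bandlimited_integral_eq_entire[OF \<phi>] by blast
  have contF: "continuous_on S (\<lambda>x. F (of_real x))" for S :: "real set"
    by (intro continuous_on_compose2[OF holomorphic_on_imp_continuous_on[OF F]] continuous_intros) auto
  have intF: "set_integrable lborel {a<..b} (\<lambda>x. F (of_real x))" for a b :: real
    by (rule set_integrable_subset[OF borel_integrable_atLeastAtMost'[OF contF[of "{a..b}"]]]) auto
  have int\<phi>: "set_integrable lborel {a<..b} (\<lambda>x. complex_of_real (\<phi> x))" for a b
    unfolding set_integrable_def using \<phi> by (intro integrable_mult_indicator) auto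
  have "AE x in lborel. complex_of_real (\<phi> x) - F (of_real x) = 0"
  proof (rule set_lebesgue_integral_Ioc_zero_imp_AE_zero)
    show "set_integrable lborel {a<..b} (\<lambda>x. complex_of_real (\<phi> x) - F (of_real x))" for a b
      by (intro set_integral_diff intF int\<phi>)
    fix a b :: real assume ab: "a \<le> b"
    have "(CLINT x:{a<..b}|lborel. F (of_real x)) = integral {a<..b} (\<lambda>x. F (of_real x))"
      by (rule set_borel_integral_eq_integral(2)[OF intF])
    also have "\<dots> = integral {a..b} (\<lambda>x. F (of_real x))"
      by (rule integral_subset_negligible) (auto intro: negligible_subset[of "{a}"])
    also have "\<dots> = (CLINT x:{a<..b}|lborel. complex_of_real (\<phi> x))"
      using eq[OF ab] by (simp add: set_integral_complex_of_real)
    finally show "(CLINT x:{a<..b}|lborel. complex_of_real (\<phi> x) - F (of_real x)) = 0"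
      by (simp add: set_integral_diff intF int\<phi>)
  qed
  then have "AE x in lborel. complex_of_real (\<phi> x) = F (of_real x)" by simp
  with F show ?thesis using that by blast
qed

section \<open>From almost everywhere on the line to the whole plane\<close>

text \<open>The set of agreement is closed, and a closed set of full measure is the whole
  line.\<close>

lemma AE_lborel_eq_continuous_imp_eq:
  fixes p q :: "real \<Rightarrow> complex"
  assumes "continuous_on UNIV p" "continuous_on UNIV q" "AE x in lborel. p x = q x"
  shows "p x = q x"
proof -
  have "x \<in> {x. p x = q x}"
    using assms by (intro mem_closed_if_AE_lebesgue closed_Collect_eq) (auto simp: AE_completion)
  then show ?thesis by simp
qed

lemma holomorphic_eq_on_reals_imp_eq:
  assumes "p holomorphic_on UNIV" "q holomorphic_on UNIV" "\<And>x::real. p (of_real x) = q (of_real x)"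
  shows "p z = q z"
proof -
  have "p z - q z = 0"
  proof (rule analytic_continuation[where f = "\<lambda>z. p z - q z" and S = UNIV and U = "\<real>" and \<xi> = 0])
    show "(\<lambda>z. p z - q z) holomorphic_on UNIV" using assms by (intro holomorphic_intros)
    show "(0::complex) islimpt \<real>"
      unfolding islimpt_approachable
    proof (intro allI impI)
      fix e :: real assume "e > 0"
      then show "\<exists>x'\<in>\<real>. x' \<noteq> 0 \<and> dist x' (0::complex) < e"
        by (intro bexI[of _ "of_real (e / 2)"]) (auto simp del: of_real_divide)
    qed
  qed (use assms in \<open>auto elim: Reals_cases\<close>)
  then show ?thesis by simp
qed

section \<open>Rigidity of entire right inverses\<close>

text \<open>While \<open>G w\<close> stays in a ball, \<open>w = g (G w)\<close> stays in the
  bounded image of that ball. So \<open>G\<close> tends to infinity, and an entire function with a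
  pole at infinity is a polynomial.\<close>

lemma entire_right_inverse_is_polynomial:
  assumes G: "G holomorphic_on UNIV" and g: "continuous_on UNIV g" and inv: "\<And>w. g (G w) = w"
  obtains a n where "\<And>w::complex. G w = (\<Sum>i\<le>n. a i * w ^ i)"
proof -
  have "filterlim G at_infinity at_infinity"
    unfolding filterlim_at_infinity[OF order_refl]
  proof (intro allI impI)
    fix r :: real
    have "bounded (g ` cball 0 r)"
      using g by (intro compact_imp_bounded compact_continuous_image) (auto intro: continuous_on_subset)
    then obtain B where B: "\<And>z. norm z \<le> r \<Longrightarrow> norm (g z) \<le> B"
      unfolding bounded_iff by (metis image_eqI mem_cball_0)
    have "norm (G w) \<ge> r" if "norm w \<ge> B + 1" for w
      using B[of "G w"] that inv[of w] by force
    then show "eventually (\<lambda>w. r \<le> norm (G w)) at_infinity"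
      unfolding eventually_at_infinity by blast
  qed
  then have "((inverse \<circ> G) \<longlongrightarrow> 0) at_infinity"
    unfolding comp_def by (rule filterlim_compose[OF tendsto_inverse_0])
  then show ?thesis using pole_at_infinity[OF G] that by blast
qed

text \<open>A nonzero coefficient of positive index makes the modulus grow beyond
  \<open>K + 1\<close> far out, in particular at a large real point, against the bound.\<close>

lemma polynomial_bounded_on_reals_imp_constant:
  fixes c :: "nat \<Rightarrow> complex"
  assumes "\<And>x::real. norm (\<Sum>i\<le>n. c i * of_real x ^ i) \<le> K" 
  shows "(\<Sum>i\<le>n. c i * z ^ i) = c 0"
proof (cases "\<exists>k\<in>{1..n}. c k \<noteq> 0")
  case True
  then obtain k where k: "k \<in> {1..n}" "c k \<noteq> 0" by blast
  have "eventually (\<lambda>z. K + 1 \<le> norm (\<Sum>i\<le>n. c i * z ^ i)) at_infinity"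
    using k by (intro polyfun_extremal) (auto simp: Suc_le_eq)
  then obtain B where B: "\<And>z. norm z \<ge> B \<Longrightarrow> K + 1 \<le> norm (\<Sum>i\<le>n. c i * z ^ i)"
    unfolding eventually_at_infinity by blast
  show ?thesis using B[of "of_real \<bar>B\<bar>"] assms[of "\<bar>B\<bar>"] by (force simp: abs_ge_self)
next
  case False
  then have "(\<Sum>i\<le>n. c i * z ^ i) = (\<Sum>i\<in>{0}. c i * z ^ i)"
    by (intro sum.mono_neutral_right) (auto simp: Suc_le_eq)
  then show ?thesis by simp
qed

section \<open>The inverse of \<open>g_fun \<alpha> f\<close>\<close>

lemma surj_linear_plus_bounded:
  fixes f :: "real \<Rightarrow> real"
  assumes cont: "continuous_on UNIV f" and bd: "\<And>t. \<bar>f t\<bar> \<le> K" and "\<alpha> > 0"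
  shows "surj (g_fun \<alpha> f)"
proof -
  have "\<exists>t. g_fun \<alpha> f t = u" for u
  proof -
    have K: "K \<ge> 0" using bd[of 0] by linarith
    \<comment> \<open>Chosen so that the linear term at \<open>s\<close> and \<open>-s\<close>
      outweighs both \<open>u\<close> and \<open>f\<close>, which brackets \<open>u\<close> for the
      intermediate value theorem.\<close>
    define s where "s = (\<bar>u\<bar> + K) / \<alpha>"
    have s: "\<alpha> * s = \<bar>u\<bar> + K" "s \<ge> 0" using K \<open>\<alpha> > 0\<close> by (auto simp: s_def)
    have "\<exists>t\<ge>-s. t \<le> s \<and> g_fun \<alpha> f t = u"
    proof (rule IVT')
      show "g_fun \<alpha> f (-s) \<le> u" "u \<le> g_fun \<alpha> f s"
        using bd[of s] bd[of "-s"] s by (auto simp: g_fun_def)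
      show "continuous_on {-s..s} (g_fun \<alpha> f)"
        unfolding g_fun_def[abs_def] by (intro continuous_intros continuous_on_subset[OF cont]) auto
    qed (use s in auto)
    then show ?thesis by blast
  qed
  then show ?thesis by (metis surjI)
qed

lemma h_fun_not_bandlimited:
  fixes f :: "real \<Rightarrow> real"
  assumes cont: "continuous_on UNIV f" and band: "bandlimited_hz \<tau> f"
    and bd: "\<And>t. \<bar>f t\<bar> \<le> K" and lim: "(f \<longlongrightarrow> 0) at_top"
    and nz: "f t0 \<noteq> 0" and \<alpha>: "\<alpha> > 0"
  shows "\<not> bandlimited_hz \<tau>' (h_fun \<alpha> f)"
proof
  assume "bandlimited_hz \<tau>' (h_fun \<alpha> f)"
  then obtain H where H: "H holomorphic_on UNIV" "AE u in lborel. complex_of_real (h_fun \<alpha> f u) = H (of_real u)"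
    using bandlimited_AE_eq_entire by blast
  obtain F where F: "F holomorphic_on UNIV" "AE t in lborel. complex_of_real (f t) = F (of_real t)"
    using bandlimited_AE_eq_entire[OF band] by blast
  have contR: "continuous_on UNIV (\<lambda>x::real. P (of_real x))" if "P holomorphic_on UNIV" for P :: "complex \<Rightarrow> complex"
    by (intro continuous_on_compose2[OF holomorphic_on_imp_continuous_on[OF that]] continuous_intros) auto
  have fF: "complex_of_real (f t) = F (of_real t)" for t
    by (rule AE_lborel_eq_continuous_imp_eq[OF _ contR[OF F(1)] F(2)]) (intro continuous_intros cont)
  have right_inv: "g_fun \<alpha> f (inv (g_fun \<alpha> f) u) = u" for u
    by (rule surj_f_inv_f[OF surj_linear_plus_bounded[OF cont bd \<alpha>]])
  define g where "g z = of_real \<alpha> * z + F z" for z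
  define G where "G w = w / of_real \<alpha> + H w" for w
  have g: "g holomorphic_on UNIV" and G: "G holomorphic_on UNIV"
    unfolding g_def[abs_def] G_def[abs_def] by (intro holomorphic_intros F H; use \<alpha> in simp)+
  have gG: "g \<circ> G holomorphic_on UNIV"
    by (rule holomorphic_on_compose[OF G holomorphic_on_subset[OF g]]) simp
  have "AE u in lborel. (g \<circ> G) (of_real u) = of_real u"
    using H(2)
  proof eventually_elim
    case (elim u)
    then have "G (of_real u) = of_real (inv (g_fun \<alpha> f) u)"
      by (simp add: G_def h_fun_def flip: elim)
    then have "(g \<circ> G) (of_real u) = of_real (g_fun \<alpha> f (inv (g_fun \<alpha> f) u))"
      by (simp add: g_def g_fun_def fF)
    then show ?case by (simp add: right_inv)
  qed
  then have "(g \<circ> G) (of_real u) = of_real u" for u :: real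
    by (rule AE_lborel_eq_continuous_imp_eq[OF contR[OF gG] continuous_on_of_real[OF continuous_on_id]])
  then have gG_id: "g (G w) = w" for w
    using holomorphic_eq_on_reals_imp_eq[OF gG holomorphic_on_id, of w] by simp
  obtain a n where a: "\<And>w. G w = (\<Sum>i\<le>n. a i * w ^ i)"
    using entire_right_inverse_is_polynomial[OF G holomorphic_on_imp_continuous_on[OF g] gG_id] by blast
  \<comment> \<open>The coefficients of \<open>G w - w / \<alpha>\<close>. The sum below runs to
    \<open>Suc n\<close> so that the linear term is present even when \<open>n = 0\<close>.\<close>
  define c where "c i = (if i \<le> n then a i else 0) - (if i = 1 then 1 / of_real \<alpha> else 0)" for i
  have H_poly: "H w = (\<Sum>i\<le>Suc n. c i * w ^ i)" for w
  proof -
    have "(\<Sum>i\<le>Suc n. c i * w ^ i) = (\<Sum>i\<le>Suc n. (if i \<le> n then a i else 0) * w ^ i) - (\<Sum>i\<le>Suc n. (if i = 1 then 1 / of_real \<alpha> else 0) * w ^ i)"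
      by (simp only: c_def left_diff_distrib sum_subtractf)
    also have "(\<Sum>i\<le>Suc n. (if i \<le> n then a i else 0) * w ^ i) = G w"
      by (simp add: a)
    also have "(\<Sum>i\<le>Suc n. (if i = 1 then 1 / of_real \<alpha> else 0) * w ^ i) = (\<Sum>i\<in>{1}. (if i = 1 then 1 / of_real \<alpha> else 0) * w ^ i)"
      by (intro sum.mono_neutral_right) auto
    finally show ?thesis by (simp add: G_def)
  qed
  have h_bd: "\<bar>h_fun \<alpha> f u\<bar> \<le> K / \<alpha>" for u
  proof -
    \<comment> \<open>Dividing \<open>\<alpha> * t + f t = u\<close> at
      \<open>t = inv (g_fun \<alpha> f) u\<close> by \<open>\<alpha>\<close> shows that
      \<open>h_fun\<close> is \<open>- f t / \<alpha>\<close>, hence inherits the bound of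
      \<open>f\<close>.\<close>
    have "u / \<alpha> = inv (g_fun \<alpha> f) u + f (inv (g_fun \<alpha> f) u) / \<alpha>"
      using right_inv[of u] \<alpha>
      by (metis add_divide_distrib g_fun_def less_irrefl nonzero_mult_div_cancel_left)
    then have "h_fun \<alpha> f u = - f (inv (g_fun \<alpha> f) u) / \<alpha>"
      by (simp add: h_fun_def)
    then show ?thesis using bd \<alpha> by (simp add: divide_right_mono)
  qed
  have H_bd: "norm (H (of_real u)) \<le> K / \<alpha>" for u :: real
  proof -
    have "AE u in lborel. (of_real u :: complex) \<in> {z. norm (H z) \<le> K / \<alpha>}"
      using H(2) by eventually_elim (metis h_bd mem_Collect_eq norm_of_real)
    then have "AE u in lebesgue. u \<in> {u::real. norm (H (of_real u)) \<le> K / \<alpha>}"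
      by (simp add: AE_completion)
    moreover have "closed {u::real. norm (H (of_real u)) \<le> K / \<alpha>}"
      by (intro closed_Collect_le continuous_intros contR H)
    ultimately show ?thesis using mem_closed_if_AE_lebesgue by blast
  qed
  have "H w = c 0" for w
    using polynomial_bounded_on_reals_imp_constant[where n = "Suc n" and c = c and K = "K / \<alpha>" and z = w] H_bd H_poly by simp
  \<comment> \<open>With \<open>H\<close> constant, \<open>G\<close> is affine and this argument
    solves \<open>G w = z\<close>; applying \<open>g\<close> then gives \<open>g z\<close>
    explicitly and leaves only a constant for \<open>F\<close>.\<close>
  then have "G (of_real \<alpha> * (z - c 0)) = z" for z
    using \<alpha> by (simp add: G_def)
  then have "F z = - of_real \<alpha> * c 0" for z
    using gG_id[of "of_real \<alpha> * (z - c 0)"] by (simp add: g_def algebra_simps eq_neg_iff_add_eq_0)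
  then have "f t = f t0" for t
    using fF[of t] fF[of t0] by (metis of_real_eq_iff)
  then have "f = (\<lambda>_. f t0)" by blast
  then have "((\<lambda>_::real. f t0) \<longlongrightarrow> 0) at_top" using lim by simp
  with nz show False by (simp add: tendsto_const_iff)
qed

theorem theorem3:
  fixes \<sigma> A :: real and f :: "real \<Rightarrow> real"
  assumes "\<sigma> > 0" and "A > 0"
    and "continuous_on UNIV f"
    and "bandlimited \<sigma> f"
    and "\<And>t. \<bar>f t\<bar> \<le> A / (1 + t\<^sup>2)"
    and "\<exists>t. f t \<noteq> 0"
  shows "\<forall>\<alpha> \<beta>. \<alpha> > A * \<sigma> \<and> \<beta> > A * \<sigma>
            \<and> (\<exists>\<tau>>0. bandlimited_hz \<tau> (h_fun \<alpha> f))
            \<and> (\<exists>\<tau>>0. bandlimited_hz \<tau> (h_fun \<beta> f)) \<longrightarrow> \<alpha> = \<beta>"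
proof -
  obtain t0 where t0: "f t0 \<noteq> 0" using assms(6) by blast
  have band: "bandlimited_hz (\<sigma> / (2 * pi)) f"
    using assms(4) by (simp add: bandlimited_def bandlimited_hz_def)
  have bd: "\<bar>f t\<bar> \<le> A" for t
  proof -
    have "A / (1 + t\<^sup>2) \<le> A / 1" using \<open>A > 0\<close> by (intro divide_left_mono) (auto intro: add_pos_nonneg)
    then show ?thesis using assms(5)[of t] by simp
  qed
  have "((\<lambda>t. A / (1 + t\<^sup>2)) \<longlongrightarrow> 0) at_top" by real_asymp
  then have lim: "(f \<longlongrightarrow> 0) at_top"
    by (rule Lim_null_comparison[rotated]) (use assms(5) in simp)
  \<comment> \<open>The premise of the uniqueness claim fails for every admissible
    \<open>\<alpha>\<close>, so the claim holds vacuously.\<close>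
  have "\<not> bandlimited_hz \<tau> (h_fun \<alpha> f)" if "\<alpha> > A * \<sigma>" for \<alpha> \<tau>
  proof -
    have "\<alpha> > 0" using that mult_pos_pos[OF assms(2,1)] by linarith
    then show ?thesis using h_fun_not_bandlimited[OF assms(3) band bd lim t0] by blast
  qed
  then show ?thesis by blast
qed

end
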